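(* For $m\ge 4$, call $\mathbf{x}=(x_1,\ldots,x_m)\in\mathbb{R}^m$ generic if the $\binom{m}{2}$ midpoints $(x_i+x_j)/2$, $1\le i<j\le m$, are pairwise distinct, and define its ranking pattern $$\mathrm{RP}^{\mathrm{UF}}(\mathbf{x})=\{(i_1\cdots i_m)\in\mathbb{P}_m:\ |y-x_{i_1}|<\cdots<|y-x_{i_m}|\text{ for some }y\in\mathbb{R}\},$$ where $\mathbb{P}_m$ is the set of permutations $(i_1\cdots i_m)$ of $\{1,\ldots,m\}$. Let $r_0(m)$ be the number of distinct ranking patterns $\mathrm{RP}^{\mathrm{UF}}(\mathbf{x})$ with $\mathbf{x}$ generic and $x_1<x_2<\cdots<x_m$. Then for all $m\ge 4$, $$2\left(\frac{3}{4}\right)^{m-4}\bigl\{(m-3)!\bigr\}^2\ \le\ r_0(m)\ <\ \frac{2}{m!}\left\{\frac{e\,m(m-1)^2}{8}\right\}^{m-2}.$$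
   Context: Here $e$ is Euler's number. *)

theory Defs
  imports Complex_Main
begin

text \<open>Points x = (x_1,...,x_m) are represented as functions nat => real; only the
values at indices 1..m matter. A permutation (i_1 ... i_m) of {1..m} is a list.\<close>

definition perms :: "nat \<Rightarrow> nat list set" where
  "perms m = {p. distinct p \<and> set p = {1..m}}"

definition generic :: "nat \<Rightarrow> (nat \<Rightarrow> real) \<Rightarrow> bool" where
  "generic m x \<longleftrightarrow>
     (\<forall>i j k l. 1 \<le> i \<and> i < j \<and> j \<le> m \<and> 1 \<le> k \<and> k < l \<and> l \<le> m \<and> (i, j) \<noteq> (k, l)
        \<longrightarrow> (x i + x j) / 2 \<noteq> (x k + x l) / 2)"

definition RP_UF :: "nat \<Rightarrow> (nat \<Rightarrow> real) \<Rightarrow> nat list set" where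
  "RP_UF m x = {p \<in> perms m. \<exists>y::real. sorted_wrt (\<lambda>i j. \<bar>y - x i\<bar> < \<bar>y - x j\<bar>) p}"

definition r0 :: "nat \<Rightarrow> nat" where
  "r0 m = card {RP_UF m x | x. generic m x \<and> (\<forall>i j. 1 \<le> i \<and> i < j \<and> j \<le> m \<longrightarrow> x i < x j)}"

end

(* The pattern is equivalent to the order of the midpoints, so r_0(m) counts the cells, inside the
   chamber x_1 < ... < x_m, of the arrangement of all hyperplanes x_i + x_j = x_k + x_l.
   Upper bound: adding the hyperplanes x_i = x_j, the symmetric group acts freely on cells, so m! r_0(m)
   is at most the number of cells of a central arrangement of C(m,2) + 3 C(m,4) hyperplanes in
   dimension m - 1, which deletion and restriction bounds by a sum of binomial coefficients.
   Lower bound: place a further point to the right of a configuration. Each value x_i + x_j - x_k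
   beyond x_m that it passes changes the cell. There are C(m-1,2) such values with j = m, and one
   with k = 1 for each 1 < i < j < m with x_i + x_j > x_1 + x_m; reflecting the line exchanges > and <,
   so on average half of these C(m-2,2) pairs count. Hence r_0(m+1) >= (3/4) (m-2)^2 r_0(m). *)
theory Submission
  imports Defs "HOL-Computational_Algebra.Polynomial" "HOL-Combinatorics.Permutations"
begin

text \<open>The lower bound needs care because \<open>admissible\<close> only separates sums of two
  points: several values x_i + x_j - x_k may coincide, and a coincidence would lose crossings. The
  cells that extend a given cell depend on that cell alone, so the count may be made at any point of
  it, and a small perturbation supplies one where the values counted are distinct. The hyperplanes
  x_i = x_j enter the upper bound so that the signs at a relabelled configuration reveal the
  relabelling; this makes the action free. Origin of the constants: C(m-1,2) + C(m-2,2)/2 + 1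
  exceeds (3/4)(m-2)^2 by m/4 + 1/2, and the factors (k-2)^2 for k = 4, ..., m-1 multiply to
  ((m-3)!)^2. For the upper bound, a sum of C(n,i) up to k = m-2 is below (e n / k)^k, and the
  number of hyperplanes is at most (m-2) m (m-1)^2 / 8 for m at least 4, with equality between the
  polynomial bounds at m = 4.\<close>

section \<open>Ranking patterns as orders on midpoints\<close>

definition index_pairs :: "nat \<Rightarrow> (nat \<times> nat) set" where
  "index_pairs m = {(i, j). 1 \<le> i \<and> i < j \<and> j \<le> m}"

definition pair_sum :: "(nat \<Rightarrow> real) \<Rightarrow> nat \<times> nat \<Rightarrow> real" where
  "pair_sum x p = x (fst p) + x (snd p)"

definition admissible :: "nat \<Rightarrow> (nat \<Rightarrow> real) \<Rightarrow> bool" where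
  "admissible m x \<longleftrightarrow> strict_mono_on {1..m} x \<and> inj_on (pair_sum x) (index_pairs m)"

definition midpoint_order :: "nat \<Rightarrow> (nat \<Rightarrow> real) \<Rightarrow> ((nat \<times> nat) \<times> (nat \<times> nat)) set" where
  "midpoint_order m x =
     {(p, q). p \<in> index_pairs m \<and> q \<in> index_pairs m \<and> pair_sum x p < pair_sum x q}"

definition midpoint_orders :: "nat \<Rightarrow> ((nat \<times> nat) \<times> (nat \<times> nat)) set set" where
  "midpoint_orders m = midpoint_order m ` {x. admissible m x}"

lemma pair_sum_Pair [simp]: "pair_sum x (i, j) = x i + x j"
  by (simp add: pair_sum_def)

lemma mem_index_pairs [simp]: "(i, j) \<in> index_pairs m \<longleftrightarrow> 1 \<le> i \<and> i < j \<and> j \<le> m"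
  by (simp add: index_pairs_def)

lemma finite_index_pairs [simp]: "finite (index_pairs m)"
  by (rule finite_subset[of _ "{1..m} \<times> {1..m}"]) (auto simp: index_pairs_def)

lemma card_ordered_pairs:
  fixes A :: "nat set"
  assumes "finite A"
  shows "card {(i, j). i \<in> A \<and> j \<in> A \<and> i < j} = card A choose 2"
proof -
  have "bij_betw (\<lambda>(i, j). {i, j}) {(i, j). i \<in> A \<and> j \<in> A \<and> i < j} {B. B \<subseteq> A \<and> card B = 2}"
  proof (rule bij_betwI')
    fix p q :: "nat \<times> nat"
    assume "p \<in> {(i, j). i \<in> A \<and> j \<in> A \<and> i < j}" "q \<in> {(i, j). i \<in> A \<and> j \<in> A \<and> i < j}"
    then show "((case p of (i, j) \<Rightarrow> {i, j}) = (case q of (i, j) \<Rightarrow> {i, j})) = (p = q)"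
      by (auto simp: doubleton_eq_iff)
  next
    fix B assume B: "B \<in> {B. B \<subseteq> A \<and> card B = 2}"
    then obtain i j where "B = {i, j}" "i \<noteq> j" by (auto simp: card_2_iff)
    with B have "B = (case (min i j, max i j) of (i, j) \<Rightarrow> {i, j})"
      "(min i j, max i j) \<in> {(i, j). i \<in> A \<and> j \<in> A \<and> i < j}"
      by (auto simp: min_def max_def)
    then show "\<exists>p \<in> {(i, j). i \<in> A \<and> j \<in> A \<and> i < j}. B = (case p of (i, j) \<Rightarrow> {i, j})"
      by blast
  qed auto
  then show ?thesis using n_subsets[OF assms, of 2] by (simp add: bij_betw_same_card)
qed

lemma card_index_pairs: "card (index_pairs m) = m choose 2"
proof -
  have "index_pairs m = {(i, j). i \<in> {1..m} \<and> j \<in> {1..m} \<and> i < j}" by auto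
  then show ?thesis using card_ordered_pairs[of "{1..m}"] by simp
qed

lemma admissible_iff:
  "admissible m x \<longleftrightarrow> generic m x \<and> (\<forall>i j. 1 \<le> i \<and> i < j \<and> j \<le> m \<longrightarrow> x i < x j)"
proof -
  have "strict_mono_on {1..m} x \<longleftrightarrow> (\<forall>i j. 1 \<le> i \<and> i < j \<and> j \<le> m \<longrightarrow> x i < x j)"
    by (auto simp: strict_mono_on_def)
  moreover have "inj_on (pair_sum x) (index_pairs m) \<longleftrightarrow> generic m x"
  proof
    assume inj: "inj_on (pair_sum x) (index_pairs m)"
    show "generic m x"
      unfolding generic_def
    proof (intro allI impI)
      fix i j k l
      assume "1 \<le> i \<and> i < j \<and> j \<le> m \<and> 1 \<le> k \<and> k < l \<and> l \<le> m \<and> (i, j) \<noteq> (k, l)"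
      then have "pair_sum x (i, j) \<noteq> pair_sum x (k, l)"
        using inj_onD[OF inj, of "(i, j)" "(k, l)"] by fastforce
      then show "(x i + x j) / 2 \<noteq> (x k + x l) / 2" by simp
    qed
  next
    assume gen: "generic m x"
    show "inj_on (pair_sum x) (index_pairs m)"
    proof (rule inj_onI)
      fix p q assume "p \<in> index_pairs m" "q \<in> index_pairs m" "pair_sum x p = pair_sum x q"
      then show "p = q"
        using gen[unfolded generic_def, rule_format, of "fst p" "snd p" "fst q" "snd q"]
        by (cases p, cases q) auto
    qed
  qed
  ultimately show ?thesis unfolding admissible_def by blast
qed

lemma admissible_less:
  "admissible m x \<Longrightarrow> 1 \<le> i \<Longrightarrow> i < j \<Longrightarrow> j \<le> m \<Longrightarrow> x i < x j"
  by (auto simp: admissible_iff)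

lemma pair_sum_eqD:
  "admissible m x \<Longrightarrow> pair_sum x p = pair_sum x q \<Longrightarrow> p \<in> index_pairs m \<Longrightarrow> q \<in> index_pairs m \<Longrightarrow> p = q"
  by (auto simp only: admissible_def dest: inj_onD)

lemma admissible_eq_iff:
  assumes "admissible m x" "i \<in> {1..m}" "j \<in> {1..m}"
  shows "x i = x j \<longleftrightarrow> i = j"
  using assms admissible_less[of m x i j] admissible_less[of m x j i]
  by (cases i j rule: linorder_cases) auto

lemma admissible_less_iff:
  assumes "admissible m x" "i \<in> {1..m}" "j \<in> {1..m}"
  shows "x i < x j \<longleftrightarrow> i < j"
  using assms admissible_less[of m x i j] admissible_less[of m x j i]
  by (cases i j rule: linorder_cases) auto

section \<open>Distances to a point y and the position of y among the midpoints\<close>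

lemma closer_iff:
  fixes a b y :: real
  assumes "a < b"
  shows "\<bar>y - a\<bar> < \<bar>y - b\<bar> \<longleftrightarrow> 2 * y < a + b" "\<bar>y - b\<bar> < \<bar>y - a\<bar> \<longleftrightarrow> a + b < 2 * y"
  using assms by (auto simp: abs_if)

text \<open>An asymmetric \<open>R\<close> that sorts \<open>p\<close> can hold from i to j only if
  i stands before j, and position is all that \<open>Q\<close> sees. A ranking shared by two
  configurations thus carries comparisons of distances from one to the other.\<close>

lemma sorted_wrt_transfer:
  assumes "sorted_wrt R p" "sorted_wrt Q p" "i \<in> set p" "j \<in> set p" "R i j"
    and "\<And>a b. R a b \<Longrightarrow> \<not> R b a"
  shows "Q i j"
proof -
  from assms(3,4) obtain a b where ab: "a < length p" "p ! a = i" "b < length p" "p ! b = j"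
    by (metis in_set_conv_nth)
  with assms have "a < b"
    by (metis linorder_less_linear sorted_wrt_iff_nth_less)
  with ab assms(2) show ?thesis by (metis sorted_wrt_iff_nth_less)
qed

lemma ranking_exists:
  assumes adm: "admissible m x" and y: "\<And>q. q \<in> index_pairs m \<Longrightarrow> pair_sum x q \<noteq> 2 * y"
  obtains p where "p \<in> perms m" "sorted_wrt (\<lambda>i j. \<bar>y - x i\<bar> < \<bar>y - x j\<bar>) p"
proof -
  define f where "f = (\<lambda>i. \<bar>y - x i\<bar>)"
  define p where "p = sort_key f (sorted_list_of_set {1..m})"
  have f_neq: "f i \<noteq> f j" if "1 \<le> i" "i < j" "j \<le> m" for i j
    using y[of "(i, j)"] that admissible_less[OF adm that] closer_iff[of "x i" "x j" y]
    unfolding f_def by auto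
  have "inj_on f {1..m}"
    using f_neq by (intro linorder_inj_onI) auto
  moreover have p: "set p = {1..m}" "distinct p" by (auto simp: p_def)
  ultimately have "distinct (map f p)" by (simp add: distinct_map)
  moreover have "sorted (map f p)" by (simp add: p_def)
  ultimately have "sorted_wrt (<) (map f p)" by (simp add: strict_sorted_iff)
  then have "sorted_wrt (\<lambda>i j. f i < f j) p" by (simp add: sorted_wrt_map)
  with p that show ?thesis by (simp add: perms_def f_def)
qed

text \<open>Empty sides must be allowed: y may lie beyond all midpoints, and a value passed by a new
  point may be the last one.\<close>

lemma finite_separation:
  fixes A B :: "real set"
  assumes "finite A" "finite B" "\<And>a b. a \<in> A \<Longrightarrow> b \<in> B \<Longrightarrow> a < b"
  shows "\<exists>c. (\<forall>a\<in>A. a < c) \<and> (\<forall>b\<in>B. c < b)"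
proof -
  consider "A = {}" | "B = {}" | "A \<noteq> {}" "B \<noteq> {}" by blast
  then show ?thesis
  proof cases
    case 1
    have "Min B - 1 < b" if "b \<in> B" for b using Min_le[OF assms(2) that] by simp
    with 1 show ?thesis by blast
  next
    case 2
    have "a < Max A + 1" if "a \<in> A" for a using Max_ge[OF assms(1) that] by simp
    with 2 show ?thesis by blast
  next
    case 3
    with assms have "Max A < Min B" by simp
    then obtain c where "Max A < c" "c < Min B" using dense by blast
    with 3 assms(1,2) show ?thesis by auto
  qed
qed

lemma finite_avoid_between:
  fixes a b :: real
  assumes "finite F" "a < b"
  obtains c where "a < c" "c < b" "c \<notin> F"
proof -
  have "infinite ({a<..<b} - F)" using assms by simp
  then have "{a<..<b} - F \<noteq> {}" by (metis finite.emptyI)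
  then show ?thesis by (auto intro: that)
qed

text \<open>A point y strictly between two midpoints, and on none, ranks j before i and k before l.
  The same ranking arises for \<open>x'\<close> at some \<open>y'\<close>, which then separates the
  two corresponding midpoints in the same direction.\<close>

lemma midpoint_order_subset_if_RP_UF_eq:
  assumes x: "admissible m x" and x': "admissible m x'" and eq: "RP_UF m x = RP_UF m x'"
  shows "midpoint_order m x \<subseteq> midpoint_order m x'"
proof (clarsimp simp: midpoint_order_def)
  fix i j k l
  assume le: "Suc 0 \<le> i" "i < j" "j \<le> m" "Suc 0 \<le> k" "k < l" "l \<le> m" "x i + x j < x k + x l"
  obtain c where c: "x i + x j < c" "c < x k + x l" "c \<notin> pair_sum x ` index_pairs m"
    using finite_avoid_between[of "pair_sum x ` index_pairs m"] le(7) by auto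
  define y where "y = c / 2"
  obtain p where p: "p \<in> perms m" "sorted_wrt (\<lambda>i j. \<bar>y - x i\<bar> < \<bar>y - x j\<bar>) p"
    using ranking_exists[OF x, of y] c(3) by (auto simp: y_def)
  then have "p \<in> RP_UF m x" unfolding RP_UF_def by blast
  with eq have "p \<in> RP_UF m x'" by simp
  then obtain y' where y': "sorted_wrt (\<lambda>i j. \<bar>y' - x' i\<bar> < \<bar>y' - x' j\<bar>) p"
    unfolding RP_UF_def by blast
  have mem: "i \<in> set p" "j \<in> set p" "k \<in> set p" "l \<in> set p"
    using p(1) le by (auto simp: perms_def)
  have "x i < x j" "x k < x l" "x' i < x' j" "x' k < x' l"
    using le admissible_less[OF x] admissible_less[OF x'] by auto
  note cl = closer_iff[OF this(1), of y] closer_iff[OF this(2), of y]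
    closer_iff[OF this(3), of y'] closer_iff[OF this(4), of y']
  have "\<bar>y' - x' j\<bar> < \<bar>y' - x' i\<bar>"
    by (rule sorted_wrt_transfer[OF p(2) y']) (use mem cl c in \<open>auto simp: y_def\<close>)
  moreover have "\<bar>y' - x' k\<bar> < \<bar>y' - x' l\<bar>"
    by (rule sorted_wrt_transfer[OF p(2) y']) (use mem cl c in \<open>auto simp: y_def\<close>)
  ultimately show "x' i + x' j < x' k + x' l" unfolding cl(6) cl(7) by linarith
qed

lemma RP_UF_subset_if_midpoint_order_eq:
  assumes x: "admissible m x" and x': "admissible m x'"
    and eq: "midpoint_order m x = midpoint_order m x'"
  shows "RP_UF m x \<subseteq> RP_UF m x'"
proof
  fix p assume "p \<in> RP_UF m x"
  then obtain y where p: "p \<in> perms m" and y: "sorted_wrt (\<lambda>i j. \<bar>y - x i\<bar> < \<bar>y - x j\<bar>) p"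
    unfolding RP_UF_def by blast
  \<comment> \<open>The cut that 2 * y makes among the pair sums of \<open>x\<close> is respected by
    the order of those of \<open>x'\<close>, so some \<open>y'\<close> makes the same cut there and
    yields the same ranking.\<close>
  define A where "A = {q \<in> index_pairs m. pair_sum x q < 2 * y}"
  define B where "B = {q \<in> index_pairs m. 2 * y \<le> pair_sum x q}"
  have "pair_sum x' a < pair_sum x' b" if "a \<in> A" "b \<in> B" for a b
  proof -
    have "(a, b) \<in> midpoint_order m x" using that by (auto simp: midpoint_order_def A_def B_def)
    then have "(a, b) \<in> midpoint_order m x'" by (simp only: eq)
    then show ?thesis by (simp add: midpoint_order_def)
  qed
  then have "u < v" if "u \<in> pair_sum x' ` A" "v \<in> pair_sum x' ` B" for u v
    using that by blast
  moreover have "finite (pair_sum x' ` A)" "finite (pair_sum x' ` B)"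
    by (simp_all add: A_def B_def)
  ultimately have "\<exists>c. (\<forall>a\<in>A. pair_sum x' a < c) \<and> (\<forall>b\<in>B. c < pair_sum x' b)"
    using finite_separation[of "pair_sum x' ` A" "pair_sum x' ` B"] by simp
  then obtain c where c: "\<And>a. a \<in> A \<Longrightarrow> pair_sum x' a < c" "\<And>b. b \<in> B \<Longrightarrow> c < pair_sum x' b"
    by blast
  define y' where "y' = c / 2"
  have "\<bar>y' - x' i\<bar> < \<bar>y' - x' j\<bar>"
    if ij: "i \<in> set p" "j \<in> set p" "\<bar>y - x i\<bar> < \<bar>y - x j\<bar>" for i j
  proof (cases i j rule: linorder_cases)
    case less
    have mem: "(i, j) \<in> index_pairs m" using less ij p by (auto simp: perms_def)
    have "x i < x j" "x' i < x' j" using mem admissible_less[OF x] admissible_less[OF x'] by auto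
    then show ?thesis
      using ij(3) closer_iff[of "x i" "x j" y] closer_iff[of "x' i" "x' j" y'] mem c(2)[of "(i, j)"]
      by (auto simp: B_def y'_def)
  next
    case greater
    have mem: "(j, i) \<in> index_pairs m" using greater ij p by (auto simp: perms_def)
    have "x j < x i" "x' j < x' i" using mem admissible_less[OF x] admissible_less[OF x'] by auto
    then show ?thesis
      using ij(3) closer_iff[of "x j" "x i" y] closer_iff[of "x' j" "x' i" y'] mem c(1)[of "(j, i)"]
      by (auto simp: A_def y'_def)
  qed (use ij in auto)
  then have "sorted_wrt (\<lambda>i j. \<bar>y' - x' i\<bar> < \<bar>y' - x' j\<bar>) p"
    by (rule sorted_wrt_mono_rel[OF _ y])
  with p show "p \<in> RP_UF m x'" unfolding RP_UF_def by blast
qed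

lemma RP_UF_eq_iff:
  assumes "admissible m x" "admissible m x'"
  shows "RP_UF m x = RP_UF m x' \<longleftrightarrow> midpoint_order m x = midpoint_order m x'"
  using assms midpoint_order_subset_if_RP_UF_eq RP_UF_subset_if_midpoint_order_eq
  by (metis subset_antisym)

lemma card_image_eq_if_same_kernel:
  assumes "\<And>x y. x \<in> X \<Longrightarrow> y \<in> X \<Longrightarrow> f x = f y \<longleftrightarrow> g x = g y"
  shows "card (f ` X) = card (g ` X)"
proof -
  have "bij_betw (g \<circ> inv_into X f) (f ` X) (g ` X)"
    unfolding bij_betw_def
  proof
    have g: "g (inv_into X f (f x)) = g x" if "x \<in> X" for x
      using assms[of "inv_into X f (f x)" x] that inv_into_into[of "f x" f X] f_inv_into_f[of "f x" f X]
      by blast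
    show "inj_on (g \<circ> inv_into X f) (f ` X)"
      using assms g by (auto simp: inj_on_def)
    show "(g \<circ> inv_into X f) ` f ` X = g ` X"
      using g by (simp add: image_comp cong: image_cong)
  qed
  then show ?thesis by (rule bij_betw_same_card)
qed

lemma r0_eq: "r0 m = card (midpoint_orders m)"
proof -
  have "{RP_UF m x | x. generic m x \<and> (\<forall>i j. 1 \<le> i \<and> i < j \<and> j \<le> m \<longrightarrow> x i < x j)}
      = RP_UF m ` {x. admissible m x}"
    by (auto simp: admissible_iff)
  then show ?thesis
    unfolding r0_def midpoint_orders_def
    by (simp only:) (rule card_image_eq_if_same_kernel, simp add: RP_UF_eq_iff)
qed

lemma finite_midpoint_orders: "finite (midpoint_orders m)"
proof (rule finite_subset)
  show "midpoint_orders m \<subseteq> Pow (index_pairs m \<times> index_pairs m)"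
    by (auto simp: midpoint_orders_def midpoint_order_def)
qed simp

section \<open>Sign patterns of linear forms\<close>

text \<open>These are the regions of a central hyperplane arrangement, each coded by the set of
  forms positive on it. The coordinate set \<open>S\<close> is a parameter so that restriction to a
  hyperplane can drop a coordinate.\<close>

definition sign_patterns :: "'i set \<Rightarrow> 'k set \<Rightarrow> ('k \<Rightarrow> 'i \<Rightarrow> real) \<Rightarrow> 'k set set" where
  "sign_patterns S K a =
     (\<lambda>t. {k \<in> K. 0 < (\<Sum>i\<in>S. a k i * t i)}) ` {t. \<forall>k\<in>K. (\<Sum>i\<in>S. a k i * t i) \<noteq> 0}"

lemma sign_patterns_subset_Pow: "sign_patterns S K a \<subseteq> Pow K"
  by (auto simp: sign_patterns_def)

lemma finite_sign_patterns: "finite K \<Longrightarrow> finite (sign_patterns S K a)"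
  by (rule finite_subset[OF sign_patterns_subset_Pow]) simp

lemma sum_choose_Suc: "(\<Sum>i\<le>d. Suc n choose i) = (\<Sum>i\<le>d. n choose i) + (\<Sum>i<d. n choose i)"
  by (induction d) (simp_all flip: lessThan_Suc_atMost)

text \<open>Deletion and restriction: adding \<open>h\<close> creates one extra region for each old
  region that it cuts in two, and the cut regions leave distinct traces on the hyperplane
  \<open>h\<close>, where coordinate \<open>j\<close> can be eliminated.\<close>

lemma sign_patterns_step:
  fixes a :: "'k \<Rightarrow> 'i \<Rightarrow> real"
  assumes fin: "finite K" "finite S" and h: "h \<notin> K" and j: "j \<in> S" "a h j \<noteq> 0"
  shows "\<exists>b. card (sign_patterns S (insert h K) a)
      \<le> card (sign_patterns S K a) + card (sign_patterns (S - {j}) K b)"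
proof -
  define L where "L = (\<lambda>k t. \<Sum>i\<in>S. a k i * t i)"
  \<comment> \<open>Gaussian elimination: on the hyperplane of \<open>h\<close>, t j is expressed
    through the other coordinates.\<close>
  define b where "b = (\<lambda>k i. a k i - a k j * a h i / a h j)"
  define P where "P = sign_patterns S (insert h K) a"
  define Q where "Q = (\<lambda>A. A - {h}) ` P"
  define R where "R = {A. A \<in> P \<and> insert h A \<in> P \<and> h \<notin> A}"
  have finP: "finite P" using fin by (simp add: P_def finite_sign_patterns)
  have "Q \<subseteq> sign_patterns S K a"
    using h by (auto simp: Q_def P_def sign_patterns_def) 
  then have cQ: "card Q \<le> card (sign_patterns S K a)"
    by (rule card_mono[OF finite_sign_patterns[OF fin(1)]])
  have elim: "(\<Sum>i\<in>S - {j}. b k i * t i) = L k t" if "L h t = 0" for k t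
  proof -
    have split: "L k t = a k j * t j + (\<Sum>i\<in>S - {j}. a k i * t i)" for k
      using fin(2) j(1) by (simp add: L_def sum.remove)
    have "(\<Sum>i\<in>S - {j}. b k i * t i)
        = (\<Sum>i\<in>S - {j}. a k i * t i) - a k j / a h j * (\<Sum>i\<in>S - {j}. a h i * t i)"
      by (simp add: b_def sum_subtractf sum_distrib_left algebra_simps)
    also have "(\<Sum>i\<in>S - {j}. a h i * t i) = - (a h j * t j)"
      using split[of h] that by simp
    finally show ?thesis using j(2) split[of k] by simp
  qed
  have "R \<subseteq> sign_patterns (S - {j}) K b"
  proof
    fix A assume "A \<in> R"
    then obtain t u where t: "A = {k \<in> insert h K. 0 < L k t}" "\<forall>k\<in>insert h K. L k t \<noteq> 0"
      and u: "insert h A = {k \<in> insert h K. 0 < L k u}" "\<forall>k\<in>insert h K. L k u \<noteq> 0" and hA: "h \<notin> A"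
      unfolding R_def P_def sign_patterns_def L_def by auto
    have neg: "L h t < 0" using t hA by (auto simp: not_less_iff_gr_or_eq)
    have pos: "0 < L h u" using u by auto
    \<comment> \<open>The segment from t to u meets the hyperplane of \<open>h\<close> in a positive
      multiple of this point. Both weights are positive, so signs on which t and u agree
      persist.\<close>
    define v where "v = (\<lambda>i. L h u * t i + (- L h t) * u i)"
    have "L k (\<lambda>i. c * t i + d * u i) = c * L k t + d * L k u" for k c d
      by (simp add: L_def distrib_left sum.distrib sum_distrib_left mult.left_commute)
    then have v: "L k v = L h u * L k t + (- L h t) * L k u" for k
      unfolding v_def .
    have "L h v = 0" by (simp add: v)
    have same: "k \<in> A \<longleftrightarrow> 0 < L k t" "k \<in> A \<longleftrightarrow> 0 < L k u" if "k \<in> K" for k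
      using that t u h by auto
    have sgn: "L k v \<noteq> 0 \<and> (0 < L k v \<longleftrightarrow> k \<in> A)" if "k \<in> K" for k
    proof (cases "k \<in> A")
      case True
      then have "0 < L k t" "0 < L k u" using same that by auto
      then have "0 < L k v" unfolding v using neg pos by (intro add_pos_pos mult_pos_pos) auto
      with True show ?thesis by simp
    next
      case False
      then have "L k t < 0" "L k u < 0" using same[OF that] t(2) u(2) that by force+
      then have "L h u * L k t < 0" "(- L h t) * L k u < 0"
        using neg pos by (simp_all add: mult_less_0_iff zero_less_mult_iff)
      then have "L k v < 0" unfolding v by linarith
      with False show ?thesis by simp
    qed
    have "A \<subseteq> K" using t hA by auto
    then have "A = {k \<in> K. 0 < (\<Sum>i\<in>S - {j}. b k i * v i)}" "\<forall>k\<in>K. (\<Sum>i\<in>S - {j}. b k i * v i) \<noteq> 0"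
      using sgn elim[OF \<open>L h v = 0\<close>] by auto
    then show "A \<in> sign_patterns (S - {j}) K b" unfolding sign_patterns_def by blast
  qed
  then have cR: "card R \<le> card (sign_patterns (S - {j}) K b)"
    by (rule card_mono[OF finite_sign_patterns[OF fin(1)]])
  define P0 where "P0 = {A \<in> P. h \<notin> A}"
  define P1 where "P1 = (\<lambda>A. A - {h}) ` {A \<in> P. h \<in> A}"
  \<comment> \<open>Forgetting \<open>h\<close> is injective on each of the two halves; the union of
    the images consists of the old patterns \<open>Q\<close>, the intersection of those occurring
    with both signs of \<open>h\<close>.\<close>
  have "card P = card P0 + card {A \<in> P. h \<in> A}"
    using finP by (subst card_Un_disjoint[symmetric]) (auto simp: P0_def intro: arg_cong[where f = card])
  also have "card {A \<in> P. h \<in> A} = card P1"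
    unfolding P1_def by (rule card_image[symmetric]) (auto simp: inj_on_def)
  also have "card P0 + card P1 = card (P0 \<union> P1) + card (P0 \<inter> P1)"
    using finP by (intro card_Un_Int) (auto simp: P0_def P1_def)
  also have "P0 \<union> P1 = Q"
  proof
    show "Q \<subseteq> P0 \<union> P1"
    proof
      fix B assume "B \<in> Q"
      then obtain A where "A \<in> P" "B = A - {h}" by (auto simp: Q_def)
      then show "B \<in> P0 \<union> P1" by (cases "h \<in> A") (auto simp: P0_def P1_def)
    qed
    show "P0 \<union> P1 \<subseteq> Q"
    proof
      fix B assume B: "B \<in> P0 \<union> P1"
      then show "B \<in> Q"
      proof
        assume "B \<in> P0"
        then have "B \<in> P" "B = B - {h}" by (auto simp: P0_def)
        then show ?thesis unfolding Q_def by blast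
      qed (auto simp: P1_def Q_def)
    qed
  qed
  also have "P0 \<inter> P1 = R"
  proof
    show "P0 \<inter> P1 \<subseteq> R" by (auto simp: P0_def P1_def R_def insert_absorb)
    show "R \<subseteq> P0 \<inter> P1"
    proof
      fix A assume A: "A \<in> R"
      then have "A = insert h A - {h}" by (auto simp: R_def)
      with A show "A \<in> P0 \<inter> P1" by (auto simp: P0_def P1_def R_def image_iff intro!: exI[of _ "insert h A"])
    qed
  qed
  finally show ?thesis using cQ cR unfolding P_def by (intro exI[of _ b]) linarith
qed

text \<open>The forms are homogeneous, so patterns come in antipodal pairs; this is what saves the
  binomial coefficient of top index compared with the bound for affine forms.\<close>

lemma card_sign_patterns_le:
  fixes a :: "'k \<Rightarrow> 'i \<Rightarrow> real"
  assumes "finite K" "finite S" "card K = Suc n"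
  shows "card (sign_patterns S K a) \<le> 2 * (\<Sum>i<card S. n choose i)"
  using assms
proof (induction n arbitrary: K S a)
  \<comment> \<open>A form that is identically zero excludes every point, so otherwise some
    coordinate is available for elimination.\<close>
  have zero: "sign_patterns S K a = {}" if "h \<in> K" "\<forall>i\<in>S. a h i = 0"
    for S :: "'i set" and K :: "'k set" and a h
    using that by (auto simp: sign_patterns_def intro!: bexI[of _ h])
  {
    case 0
    then obtain h where K: "K = {h}" by (auto simp: card_1_singleton_iff)
    show ?case
    proof (cases "\<forall>i\<in>S. a h i = 0")
      case True
      then show ?thesis using zero[of h K S a] K by simp
    next
      case False
      then have "card S \<noteq> 0" using 0 by auto
      moreover have "card (sign_patterns S K a) \<le> card (Pow K)"
        by (intro card_mono sign_patterns_subset_Pow) (simp add: K)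
      moreover have "(\<Sum>i<d. 0 choose i) = 1" if "d \<noteq> 0" for d
        using that by (cases d) (simp_all add: sum.lessThan_Suc_shift del: sum.lessThan_Suc)
      ultimately show ?thesis by (simp add: K card_Pow)
    qed
  next
    case (Suc n)
    then obtain h where h: "h \<in> K" by fastforce
    show ?case
    proof (cases "\<forall>i\<in>S. a h i = 0")
      case True
      then show ?thesis using zero[of h K S a] h by simp
    next
      case False
      then obtain j where j: "j \<in> S" "a h j \<noteq> 0" by blast
      define K' where "K' = K - {h}"
      have K': "K = insert h K'" "h \<notin> K'" "finite K'" "card K' = Suc n"
        using h Suc.prems by (auto simp: K'_def)
      obtain d where d: "card S = Suc d" "card (S - {j}) = d"
        using j Suc.prems by (metis card_Suc_Diff1)
      obtain b where "card (sign_patterns S K a)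
          \<le> card (sign_patterns S K' a) + card (sign_patterns (S - {j}) K' b)"
        using sign_patterns_step[of K' S h j a] K' Suc.prems(2) j by blast
      also have "\<dots> \<le> 2 * (\<Sum>i<card S. n choose i) + 2 * (\<Sum>i<card (S - {j}). n choose i)"
        using Suc.prems K' by (intro add_mono Suc.IH) auto
      also have "\<dots> = 2 * (\<Sum>i<card S. Suc n choose i)"
        unfolding d lessThan_Suc_atMost by (simp only: sum_choose_Suc distrib_left)
      finally show ?thesis .
    qed
  }
qed

text \<open>Weight the sum by q^k with q = k/n: since q is at most 1, this is at most the full
  binomial expansion of (1 + q)^n, which is below exp (q n) = e^k. The strict inequality 1 + q < exp
  q is what makes the final upper bound strict.\<close>

lemma sum_choose_less_exp:
  assumes "1 \<le> k" "k \<le> n"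
  shows "real (\<Sum>i\<le>k. n choose i) < (exp 1 * real n / real k) ^ k"
proof -
  define q where "q = real k / real n"
  have q: "0 < q" "q \<le> 1" using assms by (auto simp: q_def)
  have "q ^ k * real (\<Sum>i\<le>k. n choose i) = (\<Sum>i\<le>k. real (n choose i) * q ^ k)"
    by (simp add: sum_distrib_left mult.commute)
  also have "\<dots> \<le> (\<Sum>i\<le>k. real (n choose i) * q ^ i)"
    using q by (intro sum_mono mult_left_mono power_decreasing) auto
  also have "\<dots> \<le> (\<Sum>i\<le>n. real (n choose i) * q ^ i)"
    using assms q by (intro sum_mono2) auto
  also have "\<dots> = (q + 1) ^ n" by (simp add: binomial_ring)
  also have "\<dots> < exp q ^ n"
  proof (rule power_strict_mono)
    have "0 < q\<^sup>2" using q by simp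
    then show "q + 1 < exp q" using exp_lower_Taylor_quadratic[of q] q by linarith
  qed (use assms q in auto)
  also have "exp q ^ n = exp 1 ^ k"
    using assms by (simp add: q_def flip: exp_of_nat_mult)
  finally have "real (\<Sum>i\<le>k. n choose i) < exp 1 ^ k / q ^ k"
    using q by (simp add: field_simps)
  also have "\<dots> = (exp 1 * real n / real k) ^ k"
    using assms by (simp add: q_def power_divide power_mult_distrib)
  finally show ?thesis .
qed

section \<open>The upper bound\<close>

text \<open>With fst p < fst q < snd q, the two inequations make the pairs disjoint. Ordering them
  by first index keeps one of each form and its negative.\<close>

definition crossing_pairs :: "nat \<Rightarrow> ((nat \<times> nat) \<times> (nat \<times> nat)) set" where
  "crossing_pairs m = {(p, q). p \<in> index_pairs m \<and> q \<in> index_pairs m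
     \<and> fst p < fst q \<and> snd p \<noteq> fst q \<and> snd p \<noteq> snd q}"

text \<open>A pair of index pairs \<^term>\<open>(p, q)\<close> stands for the form \<^term>\<open>pair_sum x p - pair_sum x q\<close>;
  the diagonal pairs encode the hyperplanes \<^term>\<open>x i = x j\<close>.\<close>

definition hyperplanes :: "nat \<Rightarrow> ((nat \<times> nat) \<times> (nat \<times> nat)) set" where
  "hyperplanes m = (\<lambda>(i, j). ((i, i), (j, j))) ` index_pairs m \<union> crossing_pairs m"

text \<open>The indicators add up, so a diagonal pair (i, i) contributes 2 x i.\<close>

definition form_coeff :: "(nat \<times> nat) \<times> (nat \<times> nat) \<Rightarrow> nat \<Rightarrow> real" where
  "form_coeff h t = of_bool (fst (fst h) = t) + of_bool (snd (fst h) = t)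
     - of_bool (fst (snd h) = t) - of_bool (snd (snd h) = t)"

section \<open>The number of hyperplanes\<close>

lemma real_choose_two: "real (n choose 2) = real n * (real n - 1) / 2"
  by (induction n) (auto simp: numeral_2_eq_2 field_simps)

lemma finite_crossing_pairs: "finite (crossing_pairs m)"
  by (rule finite_subset[of _ "index_pairs m \<times> index_pairs m"]) (auto simp: crossing_pairs_def)

lemma finite_hyperplanes: "finite (hyperplanes m)"
  by (simp add: hyperplanes_def finite_crossing_pairs)

text \<open>Each crossing pair and its swap are two different ordered choices of disjoint index
  pairs. The resulting bound is 3 C(m,4).\<close>

lemma card_crossing_pairs: "2 * card (crossing_pairs m) \<le> (m choose 2) * ((m - 2) choose 2)"
proof -
  define A where "A = (\<lambda>p. {1..m} - {fst p, snd p :: nat})"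
  define B where "B = (\<lambda>p. {(k, l). k \<in> A p \<and> l \<in> A p \<and> k < l})"
  let ?L = "SIGMA p : index_pairs m. B p"
  have finB: "finite (B p)" for p
    by (rule finite_subset[of _ "{1..m} \<times> {1..m}"]) (auto simp: A_def B_def)
  have "card (A p) = m - 2" if "p \<in> index_pairs m" for p
    using that by (cases p) (auto simp: A_def card_Diff_subset)
  then have "card (B p) = (m - 2) choose 2" if "p \<in> index_pairs m" for p
    using card_ordered_pairs[of "A p"] that by (simp add: A_def B_def)
  then have card_L: "card ?L = (m choose 2) * ((m - 2) choose 2)"
    using finB by (simp add: card_index_pairs)
  have "card (crossing_pairs m) + card (prod.swap ` crossing_pairs m)
      = card (crossing_pairs m \<union> prod.swap ` crossing_pairs m)"
    by (rule card_Un_disjoint[symmetric], simp_all add: finite_crossing_pairs)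
      (auto simp: crossing_pairs_def)
  also have "\<dots> \<le> card ?L"
  proof (rule card_mono)
    show "finite ?L" using finB by (intro finite_SigmaI) auto
    show "crossing_pairs m \<union> prod.swap ` crossing_pairs m \<subseteq> ?L"
      by (auto simp: crossing_pairs_def A_def B_def index_pairs_def)
  qed
  also have "card (prod.swap ` crossing_pairs m) = card (crossing_pairs m)"
    by (rule card_image) (auto simp: inj_on_def)
  finally show ?thesis using card_L by linarith
qed

lemma card_hyperplanes_le:
  assumes "2 \<le> m"
  shows "real (card (hyperplanes m))
    \<le> real m * (real m - 1) / 2 + real m * (real m - 1) * (real m - 2) * (real m - 3) / 8"
proof -
  have "card (hyperplanes m) \<le> card (index_pairs m) + card (crossing_pairs m)"
    unfolding hyperplanes_def
    by (rule order.trans[OF card_Un_le add_mono[OF card_image_le]]) auto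
  then have "2 * card (hyperplanes m) \<le> 2 * (m choose 2) + (m choose 2) * ((m - 2) choose 2)"
    using card_crossing_pairs[of m] by (simp add: card_index_pairs)
  then have "2 * real (card (hyperplanes m))
      \<le> 2 * real (m choose 2) + real (m choose 2) * real ((m - 2) choose 2)"
    using of_nat_mono[where 'a = real] by fastforce
  also have "\<dots> = real m * (real m - 1) + real m * (real m - 1) / 2 * ((real m - 2) * (real m - 3) / 2)"
    using assms by (simp add: real_choose_two)
  finally show ?thesis by simp
qed

text \<open>The exponential estimate for binomial sums requires m - 2 <= n, hence also a lower bound
  on the number of hyperplanes.\<close>

lemma card_index_pairs_le_hyperplanes: "m choose 2 \<le> card (hyperplanes m)"
proof -
  have "m choose 2 = card ((\<lambda>(i, j). ((i, i), (j, j))) ` index_pairs m)"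
    unfolding card_index_pairs[symmetric] by (rule card_image[symmetric]) (auto simp: inj_on_def)
  also have "\<dots> \<le> card (hyperplanes m)"
    by (rule card_mono[OF finite_hyperplanes]) (simp add: hyperplanes_def)
  finally show ?thesis .
qed

section \<open>Recovering the labelling and the order from the signs\<close>

lemma form_coeff_sum:
  assumes "x 1 = 0" "{fst p, snd p, fst q, snd q} \<subseteq> {1..m}"
  shows "(\<Sum>t\<in>{2..m}. form_coeff (p, q) t * x t) = pair_sum x p - pair_sum x q"
proof -
  have "(\<Sum>t\<in>{2..m}. of_bool (v = t) * x t) = x v" if "v \<in> {1..m}" for v
  proof (cases "v = 1")
    case False
    with that have "v \<in> {2..m}" by auto
    then show ?thesis by (simp add: of_bool_def if_distrib[of "\<lambda>u. u * _"] cong: if_cong)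
  qed (use assms in \<open>auto intro!: sum.neutral\<close>)
  then show ?thesis
    using assms(2)
    by (simp add: form_coeff_def pair_sum_def algebra_simps sum.distrib sum_subtractf)
qed

lemma hyperplanes_indices:
  "(p, q) \<in> hyperplanes m \<Longrightarrow> {fst p, snd p, fst q, snd q} \<subseteq> {1..m}"
  by (auto simp: hyperplanes_def crossing_pairs_def index_pairs_def)

text \<open>The number of j with a smaller image than i is one less than the image of i, so the
  order determines every value.\<close>

lemma permutes_eq_if_same_order:
  assumes \<sigma>: "\<sigma> permutes {1..m::nat}" and \<tau>: "\<tau> permutes {1..m}"
    and eq: "\<And>i j. i \<in> {1..m} \<Longrightarrow> j \<in> {1..m} \<Longrightarrow> \<sigma> i < \<sigma> j \<longleftrightarrow> \<tau> i < \<tau> j"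
  shows "\<sigma> = \<tau>"
proof
  have card: "card {j \<in> {1..m}. \<rho> j < \<rho> i} = \<rho> i - 1"
    if \<rho>: "\<rho> permutes {1..m}" and i: "i \<in> {1..m}" for \<rho> i
  proof -
    have "\<rho> ` {j \<in> {1..m}. \<rho> j < \<rho> i} = {v \<in> \<rho> ` {1..m}. v < \<rho> i}" by auto
    also have "\<rho> ` {1..m} = {1..m}" by (rule permutes_image[OF \<rho>])
    also have "{v \<in> {1..m}. v < \<rho> i} = {1..<\<rho> i}"
      using permutes_in_image[OF \<rho>, of i] i by auto
    finally have "card (\<rho> ` {j \<in> {1..m}. \<rho> j < \<rho> i}) = \<rho> i - 1" by simp
    then show ?thesis
      using card_image[OF inj_on_subset[OF permutes_inj[OF \<rho>]], of "{j \<in> {1..m}. \<rho> j < \<rho> i}"] by simp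
  qed
  fix i
  show "\<sigma> i = \<tau> i"
  proof (cases "i \<in> {1..m}")
    case True
    then have "{j \<in> {1..m}. \<sigma> j < \<sigma> i} = {j \<in> {1..m}. \<tau> j < \<tau> i}" using eq by blast
    then have "\<sigma> i - 1 = \<tau> i - 1" using card[OF \<sigma> True] card[OF \<tau> True] by simp
    moreover have "1 \<le> \<sigma> i" "1 \<le> \<tau> i"
      using permutes_in_image[OF \<sigma>, of i] permutes_in_image[OF \<tau>, of i] True by auto
    ultimately show ?thesis by simp
  next
    case False
    then show ?thesis using \<sigma> \<tau> by (simp add: permutes_not_in)
  qed
qed

lemma admissible_sums_distinct:
  assumes x: "admissible m x" and "{i, j, k, l} \<subseteq> {1..m}" "i \<noteq> j" "k \<noteq> l" "i \<noteq> k" "i \<noteq> l"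
  shows "x i + x j \<noteq> x k + x l"
proof
  assume eq: "x i + x j = x k + x l"
  have mem: "(min i j, max i j) \<in> index_pairs m" "(min k l, max k l) \<in> index_pairs m"
    using assms by (auto simp: min_def max_def)
  have "pair_sum x (min i j, max i j) = pair_sum x (min k l, max k l)"
    using eq by (auto simp: min_def max_def)
  then have "(min i j, max i j) = (min k l, max k l)"
    using mem by (intro pair_sum_eqD[OF x])
  with assms show False by (auto simp: min_def max_def split: if_splits)
qed

lemma hyperplanes_nonzero:
  assumes x: "admissible m x" and \<sigma>: "\<sigma> permutes {1..m}" and h: "(p, q) \<in> hyperplanes m"
  shows "pair_sum (x \<circ> \<sigma>) p \<noteq> pair_sum (x \<circ> \<sigma>) q"
proof -
  have in_range: "\<sigma> i \<in> {1..m}" if "i \<in> {1..m}" for i using permutes_in_image[OF \<sigma>] that by simp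
  have inj: "\<sigma> i = \<sigma> j \<longleftrightarrow> i = j" for i j using permutes_inj[OF \<sigma>] by (auto dest: injD)
  from h consider i j where "p = (i, i)" "q = (j, j)" "(i, j) \<in> index_pairs m"
    | "(p, q) \<in> crossing_pairs m"
    by (auto simp: hyperplanes_def)
  then show ?thesis
  proof cases
    case 1
    then have "x (\<sigma> i) \<noteq> x (\<sigma> j)"
      using admissible_eq_iff[OF x in_range in_range, of i j] by (auto simp: inj)
    with 1 show ?thesis by simp
  next
    case 2
    obtain i j k l where "p = (i, j)" "q = (k, l)" by (cases p, cases q)
    then show ?thesis
      using 2 admissible_sums_distinct[OF x, of "\<sigma> i" "\<sigma> j" "\<sigma> k" "\<sigma> l"]
        in_range[of i] in_range[of j] in_range[of k] in_range[of l]
      by (auto simp: crossing_pairs_def inj)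
  qed
qed

text \<open>The diagonal forms give the order of the relabelled points and, as \<open>x\<close> is
  increasing, the permutation itself. Once the permutations agree, the crossing forms compare
  disjoint pairs; pairs sharing an index are compared by monotonicity.\<close>

lemma same_signs:
  assumes x: "admissible m x" "admissible m x'" and \<sigma>: "\<sigma> permutes {1..m}" "\<sigma>' permutes {1..m}"
    and eq: "\<And>p q. (p, q) \<in> hyperplanes m \<Longrightarrow>
      pair_sum (x \<circ> \<sigma>) q < pair_sum (x \<circ> \<sigma>) p \<longleftrightarrow> pair_sum (x' \<circ> \<sigma>') q < pair_sum (x' \<circ> \<sigma>') p"
  shows "\<sigma> = \<sigma>'" "midpoint_order m x = midpoint_order m x'"
proof -
  have eq2: "pair_sum (x \<circ> \<sigma>) p < pair_sum (x \<circ> \<sigma>) q \<longleftrightarrow> pair_sum (x' \<circ> \<sigma>') p < pair_sum (x' \<circ> \<sigma>') q"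
    if "(p, q) \<in> hyperplanes m" for p q
    using eq[OF that] hyperplanes_nonzero[OF x(1) \<sigma>(1) that] hyperplanes_nonzero[OF x(2) \<sigma>(2) that]
    by linarith
  have in_range: "\<sigma> i \<in> {1..m}" "\<sigma>' i \<in> {1..m}" if "i \<in> {1..m}" for i
    using permutes_in_image[OF \<sigma>(1)] permutes_in_image[OF \<sigma>(2)] that by auto
  have "\<sigma> i < \<sigma> j \<longleftrightarrow> \<sigma>' i < \<sigma>' j" if ij: "i \<in> {1..m}" "j \<in> {1..m}" for i j
  proof -
    have diag: "((a, a), (b, b)) \<in> hyperplanes m" if "a < b" "a \<in> {1..m}" "b \<in> {1..m}" for a b
      unfolding hyperplanes_def using that by (intro UnI1 image_eqI[of _ _ "(a, b)"]) auto
    have "x (\<sigma> i) < x (\<sigma> j) \<longleftrightarrow> x' (\<sigma>' i) < x' (\<sigma>' j)"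
      using eq[OF diag[of j i]] eq2[OF diag[of i j]] ij
      by (cases i j rule: linorder_cases) auto
    then show ?thesis
      using ij in_range by (simp add: admissible_less_iff[OF x(1)] admissible_less_iff[OF x(2)])
  qed
  then show \<sigma>_eq: "\<sigma> = \<sigma>'" by (rule permutes_eq_if_same_order[OF \<sigma>])
  have same: "x i + x j < x k + x l \<longleftrightarrow> x' i + x' j < x' k + x' l"
    if *: "{i, j, k, l} \<subseteq> {1..m}" "distinct [i, j, k, l]" for i j k l
  proof -
    \<comment> \<open>\<open>S\<close> lives on the labels before \<open>\<sigma>\<close> is
      applied, where \<open>hyperplanes\<close> lists only one orientation and sorted pairs;
      \<open>base\<close>, \<open>sorted\<close> and \<open>swap\<close> remove these restrictions
      in turn.\<close>
    define S where "S = (\<lambda>a b c d. x (\<sigma> a) + x (\<sigma> b) < x (\<sigma> c) + x (\<sigma> d)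
      \<longleftrightarrow> x' (\<sigma> a) + x' (\<sigma> b) < x' (\<sigma> c) + x' (\<sigma> d))"
    have base: "S a b c d" "S c d a b"
      if "{a, b, c, d} \<subseteq> {1..m}" "distinct [a, b, c, d]" "a < b" "c < d" "a < c" for a b c d
    proof -
      have "((a, b), (c, d)) \<in> hyperplanes m"
        using that by (auto simp: hyperplanes_def crossing_pairs_def)
      from eq[OF this] eq2[OF this] show "S a b c d" "S c d a b" by (simp_all add: S_def \<sigma>_eq)
    qed
    have sorted: "S a b c d"
      if "{a, b, c, d} \<subseteq> {1..m}" "distinct [a, b, c, d]" "a < b" "c < d" for a b c d
      using base[of a b c d] base[of c d a b] that by (cases a c rule: linorder_cases) auto
    have swap: "S a b c d \<longleftrightarrow> S b a c d" "S a b c d \<longleftrightarrow> S a b d c" for a b c d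
      by (simp_all add: S_def add.commute)
    have all: "S a b c d" if "{a, b, c, d} \<subseteq> {1..m}" "distinct [a, b, c, d]" for a b c d
    proof -
      have "S (min a b) (max a b) (min c d) (max c d)"
        using that by (intro sorted) (auto simp: min_def max_def)
      then show ?thesis
        using swap(1)[of a b] swap(2)[of _ _ c d] by (auto simp: min_def max_def split: if_splits)
    qed
    \<comment> \<open>Pulling back by the inverse turns the statement for all labels into the one
      for all points.\<close>
    define \<tau> where "\<tau> = inv \<sigma>"
    have \<tau>: "\<sigma> (\<tau> a) = a" for a by (simp add: \<tau>_def permutes_inverses[OF \<sigma>(1)])
    have "\<tau> a \<in> {1..m}" if "a \<in> {1..m}" for a
      using permutes_in_image[OF permutes_inv[OF \<sigma>(1)]] that by (simp add: \<tau>_def)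
    moreover have "distinct [\<tau> i, \<tau> j, \<tau> k, \<tau> l]"
      using *(2) by (metis \<tau> distinct_length_2_or_more distinct_singleton)
    ultimately have "S (\<tau> i) (\<tau> j) (\<tau> k) (\<tau> l)" using *(1) by (intro all) auto
    then show ?thesis by (simp add: S_def \<tau>)
  qed
  have "x i + x j < x k + x l \<longleftrightarrow> x' i + x' j < x' k + x' l"
    if "(i, j) \<in> index_pairs m" "(k, l) \<in> index_pairs m" for i j k l
  proof (cases "distinct [i, j, k, l]")
    case True
    with that show ?thesis by (intro same) auto
  next
    case False
    with that have "i = k \<or> i = l \<or> j = k \<or> j = l" by auto
    with that show ?thesis
      by (auto simp: admissible_less_iff[OF x(1)] admissible_less_iff[OF x(2)] add.commute)
  qed
  then show "midpoint_order m x = midpoint_order m x'"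
    by (auto simp: midpoint_order_def pair_sum_def)
qed

text \<open>Relabelling the points by an arbitrary permutation produces \<^term>\<open>fact m\<close> cells of the
  arrangement from each midpoint order; translating so that the first point is 0 lowers the
  dimension by one.\<close>

lemma fact_times_midpoint_orders_le:
  "fact m * card (midpoint_orders m) \<le> card (sign_patterns {2..m} (hyperplanes m) form_coeff)"
proof -
  define X where "X = (\<lambda>c. SOME x. admissible m x \<and> midpoint_order m x = c)"
  have X: "admissible m (X c)" "midpoint_order m (X c) = c" if "c \<in> midpoint_orders m" for c
  proof -
    have "\<exists>x. admissible m x \<and> midpoint_order m x = c" using that by (auto simp: midpoint_orders_def)
    from someI_ex[OF this] show "admissible m (X c)" "midpoint_order m (X c) = c" by (auto simp: X_def)
  qed
  define \<Phi> where "\<Phi> = (\<lambda>(\<sigma>, c). {h \<in> hyperplanes m.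
    pair_sum (X c \<circ> \<sigma>) (snd h) < pair_sum (X c \<circ> \<sigma>) (fst h)})"
  let ?D = "{\<sigma>. \<sigma> permutes {1..m}} \<times> midpoint_orders m"
  have "inj_on \<Phi> ?D"
  proof (rule inj_onI, clarify)
    fix \<sigma> c \<sigma>' c'
    assume *: "\<sigma> permutes {1..m}" "c \<in> midpoint_orders m" "\<sigma>' permutes {1..m}"
      "c' \<in> midpoint_orders m" "\<Phi> (\<sigma>, c) = \<Phi> (\<sigma>', c')"
    have "pair_sum (X c \<circ> \<sigma>) q < pair_sum (X c \<circ> \<sigma>) p
        \<longleftrightarrow> pair_sum (X c' \<circ> \<sigma>') q < pair_sum (X c' \<circ> \<sigma>') p"
      if "(p, q) \<in> hyperplanes m" for p q
    proof -
      have "(p, q) \<in> \<Phi> (\<sigma>, c) \<longleftrightarrow> (p, q) \<in> \<Phi> (\<sigma>', c')" using *(5) by simp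
      then show ?thesis using that by (simp add: \<Phi>_def)
    qed
    from same_signs[OF X(1)[OF *(2)] X(1)[OF *(4)] *(1,3) this]
    show "\<sigma> = \<sigma>' \<and> c = c'" using X(2) *(2,4) by simp
  qed
  then have "card ?D = card (\<Phi> ` ?D)" by (rule card_image[symmetric])
  also have "\<dots> \<le> card (sign_patterns {2..m} (hyperplanes m) form_coeff)"
  proof (rule card_mono[OF finite_sign_patterns[OF finite_hyperplanes]], clarify)
    fix \<sigma> c assume *: "\<sigma> permutes {1..m}" "c \<in> midpoint_orders m"
    \<comment> \<open>The coefficients of each form sum to zero, so this translation preserves all
      signs while making coordinate 1 vanish.\<close>
    define t where "t = (\<lambda>i. X c (\<sigma> i) - X c (\<sigma> 1))"
    have form: "(\<Sum>i\<in>{2..m}. form_coeff (p, q) i * t i)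
        = pair_sum (X c \<circ> \<sigma>) p - pair_sum (X c \<circ> \<sigma>) q" if "(p, q) \<in> hyperplanes m" for p q
      using form_coeff_sum[of t p q m] hyperplanes_indices[OF that]
      by (simp add: t_def pair_sum_def)
    have "\<Phi> (\<sigma>, c) = {h \<in> hyperplanes m. 0 < (\<Sum>i\<in>{2..m}. form_coeff h i * t i)}"
      using form by (auto simp: \<Phi>_def)
    moreover have "\<forall>h\<in>hyperplanes m. (\<Sum>i\<in>{2..m}. form_coeff h i * t i) \<noteq> 0"
      using form hyperplanes_nonzero[OF X(1)[OF *(2)] *(1)] by auto
    ultimately show "\<Phi> (\<sigma>, c) \<in> sign_patterns {2..m} (hyperplanes m) form_coeff"
      unfolding sign_patterns_def by blast
  qed
  finally show ?thesis by (simp add: card_cartesian_product card_permutations)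
qed

lemma r0_upper_bound:
  assumes "4 \<le> m"
  shows "real (r0 m) < 2 / fact m * (exp 1 * real m * (real m - 1)\<^sup>2 / 8) ^ (m - 2)"
proof -
  \<comment> \<open>One less than the number of forms, because the bound for central arrangements
    loses one in the top index of the binomials.\<close>
  define n where "n = card (hyperplanes m) - 1"
  have "2 * (m - 1) \<le> m * (m - 1)" using assms by (intro mult_right_mono) auto
  then have "m - 1 \<le> m choose 2" unfolding choose_two by linarith
  then have card_h: "card (hyperplanes m) = Suc n" and n: "m - 2 \<le> n"
    using card_index_pairs_le_hyperplanes[of m] assms by (auto simp: n_def)
  have "fact m * r0 m \<le> 2 * (\<Sum>i<card {2..m}. n choose i)"
    unfolding r0_eq
    by (rule order.trans[OF fact_times_midpoint_orders_le])
      (rule card_sign_patterns_le[OF finite_hyperplanes _ card_h], simp)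
  also have "{..<card {2..m}} = {..m - 2}" using assms by auto
  finally have "fact m * real (r0 m) \<le> 2 * real (\<Sum>i\<le>m - 2. n choose i)"
    using of_nat_mono[where 'a = real] by fastforce
  also have "\<dots> < 2 * (exp 1 * real n / real (m - 2)) ^ (m - 2)"
    using sum_choose_less_exp[of "m - 2" n] n assms by simp
  also have "\<dots> \<le> 2 * (exp 1 * real m * (real m - 1)\<^sup>2 / 8) ^ (m - 2)"
  proof -
    \<comment> \<open>This is, up to the factor 1/4, the slack between (m-2) m (m-1)^2 / 8 and the
      hyperplane count; here m >= 4 is decisive.\<close>
    have "0 \<le> real m * (real m - 1) * (real m - 4)" using assms by simp
    moreover have "real m * (real m - 1)\<^sup>2 / 8 * (real m - 2)
        = real m * (real m - 1) / 2 + real m * (real m - 1) * (real m - 2) * (real m - 3) / 8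
          + real m * (real m - 1) * (real m - 4) / 4"
      by (simp add: field_simps power2_eq_square)
    moreover have "real n \<le> real (card (hyperplanes m))" by (simp add: card_h)
    moreover have "2 \<le> m" using assms by simp
    note card_hyperplanes_le[OF this]
    moreover have m2: "real (m - 2) = real m - 2" using assms by simp
    ultimately have "real n \<le> real m * (real m - 1)\<^sup>2 / 8 * real (m - 2)"
      unfolding m2 by linarith
    then have "real n / real (m - 2) \<le> real m * (real m - 1)\<^sup>2 / 8"
      using assms by (subst pos_divide_le_eq) auto
    then have "exp 1 * (real n / real (m - 2)) \<le> exp 1 * (real m * (real m - 1)\<^sup>2 / 8)"
      by (rule mult_left_mono) simp
    then have "exp 1 * real n / real (m - 2) \<le> exp 1 * real m * (real m - 1)\<^sup>2 / 8"
      by (simp only: mult.assoc times_divide_eq_right)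
    then show ?thesis by (intro mult_left_mono power_mono) simp_all
  qed
  finally have "real (r0 m) < 2 * (exp 1 * real m * (real m - 1)\<^sup>2 / 8) ^ (m - 2) / fact m"
    by (simp only: pos_less_divide_eq fact_gt_zero mult.commute)
  then show ?thesis by (simp only: times_divide_eq_left)
qed

section \<open>The lower bound\<close>

text \<open>An equality x i + x j - x k = x i' + x j' - x k' becomes one of three-term sums after
  moving the subtracted terms across. Multisets allow for repeated indices.\<close>

definition strongly_generic :: "nat \<Rightarrow> (nat \<Rightarrow> real) \<Rightarrow> bool" where
  "strongly_generic m x \<longleftrightarrow>
     (\<forall>i j k i' j' k'. {i, j, k, i', j', k'} \<subseteq> {1..m} \<and> x i + x j + x k = x i' + x j' + x k'
        \<longrightarrow> {#i, j, k#} = {#i', j', k'#})"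

section \<open>Perturbing a configuration inside its cell\<close>

lemma eventually_notin_finite:
  fixes a :: "'a :: t1_space"
  assumes "finite F"
  shows "\<forall>\<^sub>F y in at a within S. y \<notin> F"
proof -
  have "\<forall>\<^sub>F y in at a within S. \<forall>b\<in>F. y \<noteq> b"
    using assms by (intro eventually_ball_finite ballI eventually_neq_at_within)
  then show ?thesis by (rule eventually_mono) blast
qed

text \<open>The perturbation e ^ i tends to 0 because i >= 1, so strict inequalities survive. Lists
  cover single points and pairs alike.\<close>

lemma eventually_less_perturbed:
  fixes x :: "nat \<Rightarrow> real"
  assumes "\<forall>i\<in>set xs \<union> set ys. 1 \<le> i" "sum_list (map x xs) < sum_list (map x ys)"
  shows "\<forall>\<^sub>F e in at_right 0.
    sum_list (map (\<lambda>i. x i + e ^ i) xs) < sum_list (map (\<lambda>i. x i + e ^ i) ys)"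
proof -
  have tendsto: "((\<lambda>e. sum_list (map (\<lambda>i. x i + e ^ i) zs)) \<longlongrightarrow> sum_list (map x zs)) (at_right 0)"
    if "\<forall>i\<in>set zs. 1 \<le> i" for zs
    using that
  proof (induction zs)
    case (Cons i zs)
    have "((\<lambda>e::real. x i + e ^ i) \<longlongrightarrow> x i + 0 ^ i) (at_right 0)" by (intro tendsto_intros)
    moreover have "(0::real) ^ i = 0" using Cons.prems by simp
    ultimately have "((\<lambda>e::real. x i + e ^ i) \<longlongrightarrow> x i) (at_right 0)" by simp
    from tendsto_add[OF this Cons.IH] Cons.prems show ?case by simp
  qed simp
  have "((\<lambda>e. sum_list (map (\<lambda>i. x i + e ^ i) ys) - sum_list (map (\<lambda>i. x i + e ^ i) xs))
      \<longlongrightarrow> sum_list (map x ys) - sum_list (map x xs)) (at_right 0)"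
    using assms(1) by (intro tendsto_diff tendsto) auto
  from order_tendstoD(1)[OF this, of 0] assms(2) show ?thesis by simp
qed

text \<open>As polynomials in e, the two sums have the multiplicities of i as coefficients of e ^ i.
  Exponents start at 1, so the values x i affect only the constant term and cannot cancel the
  difference.\<close>

lemma eventually_neq_perturbed:
  fixes x :: "nat \<Rightarrow> real"
  assumes "\<forall>i\<in>#M + N. 1 \<le> i" "M \<noteq> N"
  shows "\<forall>\<^sub>F e in at_right 0. (\<Sum>i\<in>#M. x i + e ^ i) \<noteq> (\<Sum>i\<in>#N. x i + e ^ i)"
proof -
  define p where "p = (\<lambda>M. \<Sum>i\<in>#M. [:x i:] + monom 1 i)"
  have poly_p: "poly (p M) e = (\<Sum>i\<in>#M. x i + e ^ i)" for M e
    by (induction M) (simp_all add: p_def poly_monom)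
  have coeff_p: "coeff (p M) i = real (count M i)" if "1 \<le> i" for M i
    using that by (induction M) (auto simp: p_def coeff_pCons split: nat.splits)
  have "p M - p N \<noteq> 0"
  proof
    assume "p M - p N = 0"
    then have "count M i = count N i" if "1 \<le> i" for i
      using coeff_p[OF that, of M] coeff_p[OF that, of N] by simp
    moreover have "count M i = 0" "count N i = 0" if "\<not> 1 \<le> i" for i
      using assms(1) that by (auto simp: count_eq_zero_iff)
    ultimately have "M = N" by (metis multiset_eqI)
    with assms(2) show False by simp
  qed
  then have "finite {e. poly (p M - p N) e = 0}" by (rule poly_roots_finite)
  then have "\<forall>\<^sub>F e in at_right 0. e \<notin> {e. poly (p M - p N) e = 0}" by (rule eventually_notin_finite)
  then show ?thesis by (rule eventually_mono) (simp add: poly_p)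
qed

text \<open>Moving the i-th point by \<^term>\<open>e ^ i\<close> makes every nontrivial coincidence a nonzero
  polynomial equation in e, so it fails for all small e > 0.\<close>

lemma strongly_generic_representative:
  assumes x: "admissible m x"
  obtains x' where "admissible m x'" "midpoint_order m x' = midpoint_order m x"
    "strongly_generic m x'"
proof -
  define y where "y = (\<lambda>e i. x i + e ^ i :: real)"
  define T where "T = (\<lambda>(i, j, k). {#i, j, k#}) ` ({1..m} \<times> {1..m} \<times> {1..m})"
  have finT: "finite T" by (simp add: T_def)
  have T: "1 \<le> i" if "M \<in> T" "i \<in># M" for M i using that by (auto simp: T_def)
  have "\<forall>\<^sub>F e in at_right 0. \<forall>p\<in>index_pairs m. y e (fst p) < y e (snd p)"
  proof (intro eventually_ball_finite ballI)
    fix p assume "p \<in> index_pairs m"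
    then show "\<forall>\<^sub>F e in at_right 0. y e (fst p) < y e (snd p)"
      using eventually_less_perturbed[of "[fst p]" "[snd p]" x] admissible_less[OF x, of "fst p" "snd p"]
      by (cases p) (simp add: y_def)
  qed simp
  moreover have "\<forall>\<^sub>F e in at_right 0. \<forall>h\<in>midpoint_order m x.
      pair_sum (y e) (fst h) < pair_sum (y e) (snd h)"
  proof (intro eventually_ball_finite ballI)
    show "finite (midpoint_order m x)"
      by (rule finite_subset[of _ "index_pairs m \<times> index_pairs m"]) (auto simp: midpoint_order_def)
    fix h assume "h \<in> midpoint_order m x"
    then show "\<forall>\<^sub>F e in at_right 0. pair_sum (y e) (fst h) < pair_sum (y e) (snd h)"
      using eventually_less_perturbed[of "[fst (fst h), snd (fst h)]" "[fst (snd h), snd (snd h)]" x]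
      by (auto simp: y_def midpoint_order_def pair_sum_def)
  qed
  moreover have "\<forall>\<^sub>F e in at_right 0. \<forall>M\<in>T. \<forall>N\<in>T. M \<noteq> N \<longrightarrow> (\<Sum>i\<in>#M. y e i) \<noteq> (\<Sum>i\<in>#N. y e i)"
  proof (intro eventually_ball_finite ballI finT)
    fix M N assume "M \<in> T" "N \<in> T"
    then show "\<forall>\<^sub>F e in at_right 0. M \<noteq> N \<longrightarrow> (\<Sum>i\<in>#M. y e i) \<noteq> (\<Sum>i\<in>#N. y e i)"
      using eventually_neq_perturbed[of M N x] T by (cases "M = N") (auto simp: y_def)
  qed
  ultimately have "\<forall>\<^sub>F e in at_right 0. (\<forall>p\<in>index_pairs m. y e (fst p) < y e (snd p))
      \<and> (\<forall>h\<in>midpoint_order m x. pair_sum (y e) (fst h) < pair_sum (y e) (snd h))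
      \<and> (\<forall>M\<in>T. \<forall>N\<in>T. M \<noteq> N \<longrightarrow> (\<Sum>i\<in>#M. y e i) \<noteq> (\<Sum>i\<in>#N. y e i))"
    by (intro eventually_conj)
  then obtain e where e1: "\<And>p. p \<in> index_pairs m \<Longrightarrow> y e (fst p) < y e (snd p)"
    and e2: "\<And>h. h \<in> midpoint_order m x \<Longrightarrow> pair_sum (y e) (fst h) < pair_sum (y e) (snd h)"
    and e3: "\<And>M N. M \<in> T \<Longrightarrow> N \<in> T \<Longrightarrow> M \<noteq> N \<Longrightarrow> (\<Sum>i\<in>#M. y e i) \<noteq> (\<Sum>i\<in>#N. y e i)"
    using eventually_happens'[OF trivial_limit_at_right_real] by blast
  \<comment> \<open>The order is total on index pairs, so keeping its finitely many strict
    inequalities already gives an equivalence.\<close>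
  have pres: "pair_sum x p < pair_sum x q \<longleftrightarrow> pair_sum (y e) p < pair_sum (y e) q"
    if "p \<in> index_pairs m" "q \<in> index_pairs m" for p q
  proof -
    have "pair_sum (y e) p < pair_sum (y e) q" if "pair_sum x p < pair_sum x q"
      "p \<in> index_pairs m" "q \<in> index_pairs m" for p q
      using e2[of "(p, q)"] that by (simp add: midpoint_order_def)
    note mono = this[OF _ that] this[OF _ that(2) that(1)]
    show ?thesis
    proof (cases "p = q")
      case False
      then have "pair_sum x p \<noteq> pair_sum x q" using pair_sum_eqD[OF x _ that] by blast
      with mono show ?thesis by linarith
    qed simp
  qed
  have "admissible m (y e)"
    unfolding admissible_def
  proof
    show "strict_mono_on {1..m} (y e)"
      using e1[of "(i, j)" for i j] by (auto simp: strict_mono_on_def)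
    show "inj_on (pair_sum (y e)) (index_pairs m)"
    proof (rule inj_onI)
      fix p q assume pq: "p \<in> index_pairs m" "q \<in> index_pairs m" "pair_sum (y e) p = pair_sum (y e) q"
      then have "pair_sum x p = pair_sum x q" using pres[of p q] pres[of q p] by auto
      with pq(1,2) show "p = q" by (intro pair_sum_eqD[OF x])
    qed
  qed
  moreover have "midpoint_order m (y e) = midpoint_order m x"
    using pres by (auto simp: midpoint_order_def)
  moreover have "strongly_generic m (y e)"
    unfolding strongly_generic_def
  proof (intro allI impI, elim conjE)
    fix i j k i' j' k'
    assume le: "{i, j, k, i', j', k'} \<subseteq> {1..m}" and eq: "y e i + y e j + y e k = y e i' + y e j' + y e k'"
    have "{#a, b, c#} \<in> T" if "{a, b, c} \<subseteq> {1..m}" for a b c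
      unfolding T_def using that by (intro image_eqI[of _ _ "(a, b, c)"]) auto
    with le have "{#i, j, k#} \<in> T" "{#i', j', k'#} \<in> T" by simp_all
    moreover have "(\<Sum>i\<in>#{#i, j, k#}. y e i) = (\<Sum>i\<in>#{#i', j', k'#}. y e i)"
      using eq by (simp add: add.assoc)
    ultimately show "{#i, j, k#} = {#i', j', k'#}" using e3 by blast
  qed
  ultimately show ?thesis using that by blast
qed

section \<open>Adding a point on the right\<close>

definition insertion_values :: "nat \<Rightarrow> (nat \<Rightarrow> real) \<Rightarrow> real set" where
  "insertion_values m x =
     (\<lambda>(i, j, k). x i + x j - x k) ` ({1..m} \<times> {1..m} \<times> {1..m})"

lemma finite_insertion_values: "finite (insertion_values m x)"
  by (simp add: insertion_values_def)

lemma admissible_insert_right: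
  assumes x: "admissible m x" and z: "1 \<le> m" "x m < z" "z \<notin> insertion_values m x"
  shows "admissible (Suc m) (x(Suc m := z))"
proof -
  have le: "x i \<le> x m" if "i \<in> {1..m}" for i
    using that admissible_less[OF x, of i m] by (cases "i = m") auto
  \<comment> \<open>Ties between a pair with the new point and a pair without it occur only at
    insertion values; two pairs that both contain it tie only if their other points do.\<close>
  have z': "z + x k \<noteq> x i + x j" if "{i, j, k} \<subseteq> {1..m}" for i j k
  proof
    assume "z + x k = x i + x j"
    then have "z = x i + x j - x k" by simp
    with that have "z \<in> insertion_values m x"
      unfolding insertion_values_def by (intro image_eqI[of _ _ "(i, j, k)"]) auto
    with z(3) show False by contradiction
  qed
  let ?y = "x(Suc m := z)"
  show ?thesis
    unfolding admissible_def
  proof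
    show "strict_mono_on {1..Suc m} ?y"
      unfolding strict_mono_on_def
      using admissible_less[OF x] le z(2) by (auto simp: le_Suc_eq intro: le_less_trans)
    show "inj_on (pair_sum ?y) (index_pairs (Suc m))"
    proof (rule inj_onI, clarify)
      fix i j k l
      assume ij: "(i, j) \<in> index_pairs (Suc m)" and kl: "(k, l) \<in> index_pairs (Suc m)"
        and eq: "pair_sum ?y (i, j) = pair_sum ?y (k, l)"
      consider "j \<le> m" "l \<le> m" | "j = Suc m" "l \<le> m" | "j \<le> m" "l = Suc m" | "j = Suc m" "l = Suc m"
        using ij kl by fastforce
      then show "i = k \<and> j = l"
      proof cases
        case 1
        with ij kl eq have "(i, j) = (k, l)" by (intro pair_sum_eqD[OF x]) auto
        then show ?thesis by simp
      next
        case 2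
        with ij kl eq z'[of k l i] show ?thesis by (auto simp: add.commute)
      next
        case 3
        with ij kl eq z'[of i j k] show ?thesis by (auto simp: add.commute)
      next
        case 4
        with ij kl eq admissible_eq_iff[OF x, of i k] show ?thesis by auto
      qed
    qed
  qed
qed

lemma midpoint_order_insert_right:
  "midpoint_order (Suc m) (x(Suc m := z)) \<inter> index_pairs m \<times> index_pairs m = midpoint_order m x"
  by (auto simp: midpoint_order_def)

text \<open>These are the pairs with x i + x j - x 1 > x m. They are read off the order
  \<open>c\<close>, so their number is a function of the cell and can be summed over cells.\<close>

definition inner_above :: "nat \<Rightarrow> ((nat \<times> nat) \<times> (nat \<times> nat)) set \<Rightarrow> (nat \<times> nat) set" where
  "inner_above m c = {(i, j). 1 < i \<and> i < j \<and> j < m \<and> ((1, m), (i, j)) \<in> c}"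

text \<open>The fibre over \<open>c\<close> of the map that forgets the last point; distinct
  \<open>c\<close> have disjoint fibres.\<close>

definition extensions :: "nat \<Rightarrow> ((nat \<times> nat) \<times> (nat \<times> nat)) set \<Rightarrow> ((nat \<times> nat) \<times> (nat \<times> nat)) set set" where
  "extensions m c = {c' \<in> midpoint_orders (Suc m). c' \<inter> index_pairs m \<times> index_pairs m = c}"

lemma finite_inner_above: "finite (inner_above m c)"
  by (rule finite_subset[OF _ finite_index_pairs[of m]]) (auto simp: inner_above_def)

text \<open>A new point z to the right of all others crosses a midpoint hyperplane whenever it passes a
  value \<^term>\<open>x i + x j - x k\<close>. The values exceeding \<^term>\<open>x m\<close> that are used here are those with j = m
  and those with k = 1.\<close>

lemma card_extensions_ge:
  assumes x: "admissible m x" and sg: "strongly_generic m x" and m: "2 \<le> m"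
  shows "Suc (((m - 1) choose 2) + card (inner_above m (midpoint_order m x)))
    \<le> card (extensions m (midpoint_order m x))"
proof -
  define VA where "VA = (\<lambda>(k, i). x m + x i - x k) ` index_pairs (m - 1)"
  define VB where "VB = (\<lambda>(i, j). x i + x j - x 1) ` inner_above m (midpoint_order m x)"
  define V where "V = VA \<union> VB"
  have sgD: "{#i, j, k#} = {#i', j', k'#}"
    if "x i + x j + x k = x i' + x j' + x k'" "{i, j, k, i', j', k'} \<subseteq> {1..m}" for i j k i' j' k'
    using sg that unfolding strongly_generic_def by blast
  have "inj_on (\<lambda>(k, i). x m + x i - x k) (index_pairs (m - 1))"
  proof (rule inj_onI, clarify)
    fix k i k' i'
    assume *: "(k, i) \<in> index_pairs (m - 1)" "(k', i') \<in> index_pairs (m - 1)"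
      "x m + x i - x k = x m + x i' - x k'"
    then have "{#m, i, k'#} = {#m, i', k#}" by (intro sgD) auto
    then have "{#i, k'#} = {#i', k#}" by simp
    with * show "k = k' \<and> i = i'" by (auto simp: add_eq_conv_ex)
  qed
  then have card_VA: "card VA = (m - 1) choose 2"
    unfolding VA_def by (simp add: card_image card_index_pairs)
  have "inj_on (\<lambda>(i, j). x i + x j - x 1) (inner_above m (midpoint_order m x))"
  proof (rule inj_onI, clarify)
    fix i j k l
    assume *: "(i, j) \<in> inner_above m (midpoint_order m x)"
      "(k, l) \<in> inner_above m (midpoint_order m x)" "x i + x j - x 1 = x k + x l - x 1"
    then have "(i, j) = (k, l)"
      by (intro pair_sum_eqD[OF x]) (auto simp: inner_above_def)
    then show "i = k \<and> j = l" by simp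
  qed
  then have card_VB: "card VB = card (inner_above m (midpoint_order m x))"
    unfolding VB_def by (rule card_image)
  \<comment> \<open>A common value would give equal multisets, but m occurs on the side of
    \<open>VA\<close> only.\<close>
  have "VA \<inter> VB = {}"
  proof (rule ccontr)
    assume "VA \<inter> VB \<noteq> {}"
    then obtain p q where pq: "p \<in> index_pairs (m - 1)" "q \<in> inner_above m (midpoint_order m x)"
      "x m + x (snd p) - x (fst p) = x (fst q) + x (snd q) - x 1"
      unfolding VA_def VB_def case_prod_beta by blast
    obtain k i a b where "p = (k, i)" "q = (a, b)" by (cases p, cases q)
    with pq have *: "(k, i) \<in> index_pairs (m - 1)"
      "(a, b) \<in> inner_above m (midpoint_order m x)" "x m + x i - x k = x a + x b - x 1"
      by simp_all
    then have "{#m, i, 1#} = {#a, b, k#}" by (intro sgD) (auto simp: inner_above_def)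
    then have "m \<in># {#a, b, k#}" by (metis union_single_eq_member)
    with * show False by (auto simp: inner_above_def)
  qed
  then have card_V: "card V = ((m - 1) choose 2) + card (inner_above m (midpoint_order m x))"
    unfolding V_def card_VA[symmetric] card_VB[symmetric]
    by (intro card_Un_disjoint) (auto simp: VA_def VB_def finite_inner_above)
  have finV: "finite V" by (simp add: V_def VA_def VB_def finite_inner_above)
  have V_form: "\<exists>i j k. v = x i + x j - x k \<and> (i, j) \<in> index_pairs m \<and> k \<in> {1..m}" if "v \<in> V" for v
    using that m unfolding V_def VA_def VB_def
  proof (elim UnE imageE, goal_cases)
    case (1 p)
    then show ?case
      by (cases p, intro exI[of _ "snd p"] exI[of _ m] exI[of _ "fst p"]) (auto simp: add.commute)
  next
    case (2 p)
    then show ?case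
      by (cases p, intro exI[of _ "fst p"] exI[of _ "snd p"] exI[of _ 1]) (auto simp: inner_above_def)
  qed
  have V_gt: "x m < v" if "v \<in> V" for v
    using that admissible_less[OF x] unfolding V_def VA_def VB_def
    by (auto simp: inner_above_def midpoint_order_def)
  have V_sub: "V \<subseteq> insertion_values m x"
  proof
    fix v assume "v \<in> V"
    from V_form[OF this] obtain i j k where "v = x i + x j - x k" "(i, j, k) \<in> {1..m} \<times> {1..m} \<times> {1..m}"
      by auto
    then show "v \<in> insertion_values m x" unfolding insertion_values_def
      by (intro image_eqI[of _ _ "(i, j, k)"]) auto
  qed
  \<comment> \<open>z w lies just beyond w, before the next insertion value.\<close>
  have "\<forall>w. \<exists>z. (\<forall>a\<in>{w}. a < z) \<and> (\<forall>u\<in>{u \<in> insertion_values m x. w < u}. z < u)"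
    by (intro allI finite_separation) (simp_all add: finite_insertion_values)
  then obtain z where "\<forall>w. (\<forall>a\<in>{w}. a < z w) \<and> (\<forall>u\<in>{u \<in> insertion_values m x. w < u}. z w < u)"
    by (rule choice[THEN exE])
  then have z: "\<And>w. w < z w" "\<And>w u. u \<in> insertion_values m x \<Longrightarrow> w < u \<Longrightarrow> z w < u"
    by simp_all
  have z_notin: "z w \<notin> insertion_values m x" for w using z by blast
  \<comment> \<open>Starting at x m itself adds the position before any crossing, which accounts for
    the \<open>Suc\<close>.\<close>
  define W where "W = insert (x m) V"
  define f where "f = (\<lambda>w. midpoint_order (Suc m) (x(Suc m := z w)))"
  \<comment> \<open>The value w' = x i + x j - x k lies between z w and z w', so the comparison of
    the new point plus x k with x i + x j has different outcomes.\<close>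
  have neq: "f w \<noteq> f w'" if "w \<in> W" "w' \<in> W" "w < w'" for w w'
  proof -
    have "x m \<le> w" using that(1) V_gt by (auto simp: W_def less_imp_le)
    with that have "w' \<in> V" by (auto simp: W_def)
    then obtain i j k where ijk: "w' = x i + x j - x k" "(i, j) \<in> index_pairs m" "k \<in> {1..m}"
      using V_form by blast
    have "z w < w'" "w' < z w'" using z \<open>w' \<in> V\<close> V_sub that(3) by auto
    with ijk have "((k, Suc m), (i, j)) \<in> f w" "((k, Suc m), (i, j)) \<notin> f w'"
      by (auto simp: f_def midpoint_order_def)
    then show ?thesis by blast
  qed
  have "inj_on f W" using neq by (intro linorder_inj_onI) auto
  then have "card (f ` W) = card W" by (rule card_image)
  moreover have "card W = Suc (card V)" using V_gt finV unfolding W_def by (subst card_insert_disjoint) auto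
  moreover have "f ` W \<subseteq> extensions m (midpoint_order m x)"
  proof clarify
    fix w assume "w \<in> W"
    then have "x m \<le> w" using V_gt by (auto simp: W_def less_imp_le)
    then have "admissible (Suc m) (x(Suc m := z w))"
      using m z(1)[of w] by (intro admissible_insert_right[OF x _ _ z_notin]) auto
    then show "f w \<in> extensions m (midpoint_order m x)"
      by (simp add: extensions_def midpoint_orders_def f_def midpoint_order_insert_right)
  qed
  moreover have "finite (extensions m (midpoint_order m x))"
    by (simp add: extensions_def finite_midpoint_orders)
  ultimately show ?thesis using card_mono[of "extensions m (midpoint_order m x)" "f ` W"] card_V by simp
qed

section \<open>Reflection of the line\<close>

definition mirror :: "nat \<Rightarrow> nat \<times> nat \<Rightarrow> nat \<times> nat" where
  "mirror m p = (Suc m - snd p, Suc m - fst p)"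

text \<open>Negating the points reverses comparisons, hence the exchange of p and q; reversing the
  labels makes the points increasing again.\<close>

definition reflect_order :: "nat \<Rightarrow> ((nat \<times> nat) \<times> (nat \<times> nat)) set \<Rightarrow> ((nat \<times> nat) \<times> (nat \<times> nat)) set" where
  "reflect_order m c = {(p, q). p \<in> index_pairs m \<and> q \<in> index_pairs m \<and> (mirror m q, mirror m p) \<in> c}"

lemma mirror_index_pairs: "p \<in> index_pairs m \<Longrightarrow> mirror m p \<in> index_pairs m"
  by (cases p) (auto simp: mirror_def)

lemma mirror_mirror: "p \<in> index_pairs m \<Longrightarrow> mirror m (mirror m p) = p"
  by (cases p) (auto simp: mirror_def)

lemma reflect_midpoint_order:
  "reflect_order m (midpoint_order m x) = midpoint_order m (\<lambda>i. - x (Suc m - i))"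
  by (auto simp: reflect_order_def midpoint_order_def mirror_index_pairs)
    (auto simp: mirror_def pair_sum_def)

lemma admissible_reflect:
  assumes x: "admissible m x"
  shows "admissible m (\<lambda>i. - x (Suc m - i))"
  unfolding admissible_def
proof
  show "strict_mono_on {1..m} (\<lambda>i. - x (Suc m - i))"
    using admissible_less[OF x] by (auto simp: strict_mono_on_def)
  have sum: "pair_sum (\<lambda>i. - x (Suc m - i)) p = - pair_sum x (mirror m p)" for p
    by (simp add: pair_sum_def mirror_def)
  show "inj_on (pair_sum (\<lambda>i. - x (Suc m - i))) (index_pairs m)"
  proof (rule inj_onI)
    fix p q assume pq: "p \<in> index_pairs m" "q \<in> index_pairs m"
      "pair_sum (\<lambda>i. - x (Suc m - i)) p = pair_sum (\<lambda>i. - x (Suc m - i)) q"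
    then have "mirror m p = mirror m q"
      by (intro pair_sum_eqD[OF x] mirror_index_pairs) (simp_all add: sum)
    then show "p = q" using mirror_mirror pq by metis
  qed
qed

lemma reflect_midpoint_orders: "c \<in> midpoint_orders m \<Longrightarrow> reflect_order m c \<in> midpoint_orders m"
  by (auto simp: midpoint_orders_def reflect_midpoint_order admissible_reflect)

lemma reflect_reflect: "c \<in> midpoint_orders m \<Longrightarrow> reflect_order m (reflect_order m c) = c"
  by (auto simp: midpoint_orders_def midpoint_order_def reflect_order_def mirror_mirror mirror_index_pairs)

text \<open>\<open>mirror\<close> fixes (1, m) and permutes the inner pairs, while reflection
  reverses comparisons. Thus the inner pairs above (1, m) after reflection correspond to those below
  it before, and admissibility excludes ties with (1, m).\<close>

lemma card_inner_above_reflect: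
  assumes "c \<in> midpoint_orders m" and m: "2 \<le> m"
  shows "card (inner_above m c) + card (inner_above m (reflect_order m c)) = (m - 2) choose 2"
proof -
  obtain x where x: "admissible m x" and c: "c = midpoint_order m x"
    using assms by (auto simp: midpoint_orders_def)
  define J where "J = {(i, j). 1 < i \<and> i < j \<and> j < m}"
  define B where "B = {(i, j). 1 < i \<and> i < j \<and> j < m \<and> ((i, j), (1, m)) \<in> c}"
  have finJ: "finite J" by (rule finite_subset[OF _ finite_index_pairs[of m]]) (auto simp: J_def)
  have "bij_betw (mirror m) (inner_above m (reflect_order m c)) B"
  proof (rule bij_betw_byWitness[where f' = "mirror m"])
    show "mirror m ` inner_above m (reflect_order m c) \<subseteq> B"
      by (auto simp: inner_above_def reflect_order_def mirror_def B_def)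
    show "mirror m ` B \<subseteq> inner_above m (reflect_order m c)"
      by (auto simp: inner_above_def reflect_order_def mirror_def B_def)
  qed (auto simp: inner_above_def B_def mirror_mirror)
  then have "card (inner_above m (reflect_order m c)) = card B" by (rule bij_betw_same_card)
  moreover have "card (inner_above m c) + card B = card (inner_above m c \<union> B)"
    using finJ by (intro card_Un_disjoint[symmetric] finite_subset[OF _ finJ])
      (auto simp: inner_above_def J_def B_def c midpoint_order_def)
  moreover have "inner_above m c \<union> B = J"
  proof -
    have "x i + x j \<noteq> x 1 + x m" if "1 < i" "i < j" "j < m" for i j
    proof
      assume "x i + x j = x 1 + x m"
      then have "pair_sum x (i, j) = pair_sum x (1, m)" by simp
      moreover have "(i, j) \<in> index_pairs m" "(1, m) \<in> index_pairs m" using that by auto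
      ultimately have "(i, j) = (1, m)" by (rule pair_sum_eqD[OF x])
      with that show False by simp
    qed
    then show ?thesis
      by (auto simp: inner_above_def J_def B_def c midpoint_order_def linorder_neq_iff)
  qed
  moreover have "J = {(i, j). i \<in> {2..<m} \<and> j \<in> {2..<m} \<and> i < j}" by (auto simp: J_def)
  ultimately show ?thesis using card_ordered_pairs[of "{2..<m}"] by simp
qed

text \<open>Averaging over the reflection replaces the unknown number of pairs above (1, m) by half of all
  inner pairs.\<close>

lemma r0_Suc_ge:
  assumes m: "2 \<le> m"
  shows "r0 m * (2 + 2 * ((m - 1) choose 2) + ((m - 2) choose 2)) \<le> 2 * r0 (Suc m)"
proof -
  let ?M = "midpoint_orders m" and ?u = "\<lambda>c. card (inner_above m c)"
  \<comment> \<open>Reflection is an involution on the cells, so it merely reindexes the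
    sum.\<close>
  have "(\<Sum>c\<in>?M. ?u (reflect_order m c)) = (\<Sum>c\<in>?M. ?u c)"
    by (rule sum.reindex_bij_witness[where i = "reflect_order m" and j = "reflect_order m"])
      (auto simp: reflect_reflect reflect_midpoint_orders)
  then have "2 * (\<Sum>c\<in>?M. ?u c) = (\<Sum>c\<in>?M. ?u c + ?u (reflect_order m c))"
    by (simp add: sum.distrib)
  also have "\<dots> = r0 m * ((m - 2) choose 2)"
    using m by (simp add: card_inner_above_reflect r0_eq)
  finally have "r0 m * (2 + 2 * ((m - 1) choose 2) + ((m - 2) choose 2))
      = 2 * (\<Sum>c\<in>?M. Suc (((m - 1) choose 2) + ?u c))"
    by (simp add: sum.distrib sum_Suc r0_eq algebra_simps)
  also have "(\<Sum>c\<in>?M. Suc (((m - 1) choose 2) + ?u c)) \<le> (\<Sum>c\<in>?M. card (extensions m c))"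
  proof (rule sum_mono)
    fix c assume "c \<in> ?M"
    then obtain x where "admissible m x" "c = midpoint_order m x" by (auto simp: midpoint_orders_def)
    then obtain x' where "admissible m x'" "strongly_generic m x'" "c = midpoint_order m x'"
      using strongly_generic_representative by metis
    then show "Suc (((m - 1) choose 2) + ?u c) \<le> card (extensions m c)"
      using card_extensions_ge m by metis
  qed
  also have "(\<Sum>c\<in>?M. card (extensions m c)) = card (\<Union>c\<in>?M. extensions m c)"
    by (rule card_UN_disjoint[symmetric]) (auto simp: finite_midpoint_orders extensions_def)
  also have "\<dots> \<le> r0 (Suc m)"
    unfolding r0_eq by (rule card_mono[OF finite_midpoint_orders]) (auto simp: extensions_def)
  finally show ?thesis by simp
qed

section \<open>Start and induction for the lower bound\<close>

lemma r0_3_pos: "1 \<le> r0 3"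
proof -
  \<comment> \<open>The points 1, 4, 9 have the distinct pair sums 5, 10, 13.\<close>
  define x where "x = (\<lambda>i::nat. real i ^ 2)"
  have P: "index_pairs 3 = {(1, 2), (1, 3), (2, 3)}"
    by (auto simp: index_pairs_def)
  have "admissible 3 x"
    unfolding admissible_def P
    by (auto simp: x_def strict_mono_on_def inj_on_def power_strict_mono)
  then have "midpoint_orders 3 \<noteq> {}" by (auto simp: midpoint_orders_def)
  then show ?thesis
    unfolding r0_eq by (simp add: Suc_le_eq card_gt_0_iff finite_midpoint_orders)
qed

lemma r0_lower_step:
  assumes "2 \<le> m"
  shows "3/4 * (real m - 2)\<^sup>2 * real (r0 m) \<le> real (r0 (Suc m))"
proof -
  have "real (r0 m * (2 + 2 * ((m - 1) choose 2) + ((m - 2) choose 2))) \<le> real (2 * r0 (Suc m))"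
    using r0_Suc_ge[OF assms] by (rule of_nat_mono)
  moreover have "real (2 + 2 * ((m - 1) choose 2) + ((m - 2) choose 2))
      = 2 + (real m - 1) * (real m - 2) + (real m - 2) * (real m - 3) / 2"
    using assms by (simp add: real_choose_two)
  ultimately have "real (r0 m) * (2 + (real m - 1) * (real m - 2) + (real m - 2) * (real m - 3) / 2)
      \<le> 2 * real (r0 (Suc m))"
    by (simp only: of_nat_mult of_nat_numeral)
  \<comment> \<open>The discarded surplus m/2 + 1 is what leaves a perfect square, whose product
    telescopes to a squared factorial.\<close>
  moreover have "2 + (real m - 1) * (real m - 2) + (real m - 2) * (real m - 3) / 2
      = 2 * (3/4 * (real m - 2)\<^sup>2) + (real m / 2 + 1)"
    by (simp add: field_simps power2_eq_square)
  then have "2 * (3/4 * (real m - 2)\<^sup>2)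
      \<le> 2 + (real m - 1) * (real m - 2) + (real m - 2) * (real m - 3) / 2"
    by simp
  then have "real (r0 m) * (2 * (3/4 * (real m - 2)\<^sup>2))
      \<le> real (r0 m) * (2 + (real m - 1) * (real m - 2) + (real m - 2) * (real m - 3) / 2)"
    by (rule mult_left_mono) simp
  ultimately have "real (r0 m) * (2 * (3/4 * (real m - 2)\<^sup>2)) \<le> 2 * real (r0 (Suc m))"
    by linarith
  then show ?thesis by (simp add: mult.commute)
qed

lemma r0_lower_bound:
  assumes "4 \<le> m"
  shows "2 * (3/4) ^ (m - 4) * (fact (m - 3))\<^sup>2 \<le> real (r0 m)"
  using assms
proof (induction m rule: dec_induct)
  case base
  \<comment> \<open>The undiscarded recursion is needed here: at m = 3 it gives the factor 2, while
    \<open>r0_lower_step\<close> would give only 3/4.\<close>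
  have "r0 3 * 4 \<le> 2 * r0 4"
    using r0_Suc_ge[of 3] by (simp add: choose_two)
  then have "2 \<le> r0 4" using r0_3_pos by linarith
  then show ?case by (simp add: fact_numeral)
next
  case (step m)
  obtain k where k: "m = k + 4" using step.hyps by (metis le_add_diff_inverse2)
  have "2 * (3/4) ^ (Suc m - 4) * (fact (Suc m - 3))\<^sup>2
      = 3/4 * (real m - 2)\<^sup>2 * (2 * (3/4) ^ (m - 4) * (fact (m - 3))\<^sup>2 :: real)"
    by (simp add: k algebra_simps eval_nat_numeral)
  also have "\<dots> \<le> 3/4 * (real m - 2)\<^sup>2 * real (r0 m)"
    using step.IH by (intro mult_left_mono) auto
  also have "\<dots> \<le> real (r0 (Suc m))" using step.hyps by (intro r0_lower_step) auto
  finally show ?case .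
qed

theorem theorem3p4:
  fixes m :: nat
  assumes "m \<ge> 4"
  shows "2 * (3/4) ^ (m - 4) * (fact (m - 3))\<^sup>2 \<le> real (r0 m)
       \<and> real (r0 m) < 2 / fact m * (exp 1 * real m * (real m - 1)\<^sup>2 / 8) ^ (m - 2)"
  using r0_lower_bound[OF assms] r0_upper_bound[OF assms] by blast

end
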